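(* As $n\to\infty$, the average height of all partial Łukasiewicz paths read from right to left of length $n$, with unspecified end point (each such path being equally likely), is asymptotically equivalent to $\sqrt{\pi n}$.
   Context: A partial Łukasiewicz path read from right to left, of length $n\ge0$, is a lattice path starting at $(0,0)$, consisting of $n$ steps from $\{(1,j): j\in\mathbb{Z},\ j\le 1\}$, and never going below the $x$-axis. Its height is the maximal $y$-coordinate of its points. For each $n$ there are finitely many such paths. Two sequences are asymptotically equivalent if their ratio tends to $1$. *)

theory Defs
  imports "HOL-Analysis.Analysis" "HOL-Library.Landau_Symbols"
begin

text \<open>
  A lattice path from \<open>(0,0)\<close> with steps of the form \<open>(1,j)\<close> is encoded by the list \<open>js\<close> of the
  second components of its steps; its points are \<open>(k, path_level js k)\<close> for \<open>k \<le> length js\<close>.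
\<close>

definition path_level :: "int list \<Rightarrow> nat \<Rightarrow> int" where
  "path_level js k = sum_list (take k js)"

definition partial_lukasiewicz_rl :: "nat \<Rightarrow> int list set" where
  "partial_lukasiewicz_rl n =
     {js. length js = n \<and> (\<forall>j\<in>set js. j \<le> 1) \<and> (\<forall>k\<le>n. 0 \<le> path_level js k)}"

definition path_height :: "int list \<Rightarrow> int" where
  "path_height js = Max (path_level js ` {0..length js})"

definition average_height :: "nat \<Rightarrow> real" where
  "average_height n =
     (\<Sum>js\<in>partial_lukasiewicz_rl n. real_of_int (path_height js)) / real (card (partial_lukasiewicz_rl n))"

text \<open>The sum and the cardinality in \<open>average_height\<close> are not degenerate:\<close>

lemma finite_partial_lukasiewicz_rl: "finite (partial_lukasiewicz_rl n)"
proof (rule finite_subset)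
  show "partial_lukasiewicz_rl n \<subseteq> {js. set js \<subseteq> {- int n..1} \<and> length js = n}"
  proof
    fix js assume js: "js \<in> partial_lukasiewicz_rl n"
    then have len: "length js = n"
      by (simp add: partial_lukasiewicz_rl_def)
    have up: "j \<le> 1" if "j \<in> set js" for j
      using js that by (simp add: partial_lukasiewicz_rl_def)
    have level: "0 \<le> path_level js k" if "k \<le> n" for k
      using js that by (simp add: partial_lukasiewicz_rl_def)
    have step: "path_level js (Suc k) = path_level js k + js ! k" if "k < n" for k
      using that len by (simp add: path_level_def take_Suc_conv_app_nth)
    have bound: "path_level js k \<le> int k" if "k \<le> n" for k
      using that
    proof (induction k)
      case 0
      then show ?case by (simp add: path_level_def)
    next
      case (Suc k)
      then have "js ! k \<le> 1" using up len by simp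
      then show ?case using Suc step[of k] by simp
    qed
    have "- int n \<le> js ! k" if "k < n" for k
      using that step[of k] level[of "Suc k"] bound[of k] by simp
    then have "set js \<subseteq> {- int n..1}"
      using up len by (auto simp: in_set_conv_nth)
    with len show "js \<in> {js. set js \<subseteq> {- int n..1} \<and> length js = n}"
      by simp
  qed
next
  show "finite {js. set js \<subseteq> {- int n..1} \<and> length js = n}"
    by (rule finite_lists_length_eq) simp
qed

lemma partial_lukasiewicz_rl_nonempty: "partial_lukasiewicz_rl n \<noteq> {}"
proof -
  have "replicate n 0 \<in> partial_lukasiewicz_rl n"
    by (auto simp: partial_lukasiewicz_rl_def path_level_def sum_list_replicate)
  then show ?thesis by blast
qed

end

theory Submission
  imports Defs "HOL-Real_Asymp.Real_Asymp"
begin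

text \<open>
  The levels of a path form a sequence of naturals starting at \<open>0\<close> in which every entry exceeds its
  predecessor by at most \<open>1\<close>. The starting levels of the up steps of a Dyck path of semilength
  \<open>N = n + 1\<close> form exactly such a sequence, so the theorem is the theorem of de Bruijn, Knuth and Rice
  on the average height of Dyck paths (or of plane trees). The proof below replaces the
  Mellin transform usually applied to the divisor function by two summations by parts.

  The reflection principle, in the form \<open>strip_count_0_eq_sum\<close>, expresses the number of paths of height
  greater than \<open>h\<close> as the sum of \<open>w(k L)\<close> over \<open>k \<ge> 1\<close>, where \<open>L = h + 3\<close> and \<open>w(m)\<close> is the second
  difference of \<open>m \<mapsto> (2N choose N + m)\<close>. For \<open>L = 1\<close> and \<open>L = 2\<close> the same sum is the number of all
  paths, the Catalan number \<open>C = (2N choose N) / (N + 1)\<close>. Summing over all \<open>L\<close> groups the terms by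
  \<open>m = k L\<close> and shows that the total height is \<open>\<Sum> d(m) w(m) - 2 C\<close> with the divisor function \<open>d\<close>
  (\<open>sum_path_height_eq_divisor_sum\<close>).

  By Dirichlet's hyperbola argument, \<open>d(m)\<close> is \<open>H(m) + \<gamma>\<close> up to an error whose partial sums are
  \<open>O(sqrt m)\<close> (\<open>dirichlet_divisor_error\<close>); here \<open>H(m)\<close> is the harmonic number. The three resulting
  sums behave as follows.

  \<^item> The sum \<open>\<Sum> \<gamma> w(m)\<close> telescopes to \<open>\<gamma> C\<close>, a bounded contribution to the average.

  \<^item> In \<open>\<Sum> H(m) w(m)\<close>, summation by parts produces \<open>1/m\<close> times a first difference of the binomial row,
    and this difference is \<open>(2m - 1) / (2N + 1)\<close> times \<open>(2N + 1 choose N + m)\<close>. The factor \<open>m\<close> cancels,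
    and what remains is half a row sum, \<open>2 * 4^N / (2N + 1)\<close>, up to a term that
    contributes \<open>O(ln N)\<close> to the average (\<open>sum_harm_binom_diff2_approx\<close>). Divided by \<open>C\<close> it is asymptotically
    \<open>4^N / (2N choose N)\<close>, hence \<open>sqrt (\<pi> N)\<close> by \<open>central_binomial_asymptotic\<close>.

  \<^item> In the error sum, summation by parts produces a third difference, which is again explicit and is
    controlled by the second and fourth moments of the binomial distribution. The contribution to the
    average is \<open>O(N^(1/4))\<close> (\<open>abel_error_bound\<close>).
\<close>

section \<open>Lacunary binomial sums\<close>

text \<open>
  The sum of \<open>T choose s\<close> over all \<open>s\<close> congruent to \<open>r\<close> modulo \<open>L\<close>. Defining it by Pascal's rule spares the
  bookkeeping of summation ranges in the alternating sums of the reflection principle.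
\<close>

fun lacunary_binomial :: "nat \<Rightarrow> nat \<Rightarrow> int \<Rightarrow> int" where
  "lacunary_binomial L 0 r = (if int L dvd r then 1 else 0)"
| "lacunary_binomial L (Suc T) r = lacunary_binomial L T r + lacunary_binomial L T (r - 1)"

lemma lacunary_binomial_periodic: "int L dvd r - r' \<Longrightarrow> lacunary_binomial L T r = lacunary_binomial L T r'"
proof (induction T arbitrary: r r')
  case 0
  then have "int L dvd r \<longleftrightarrow> int L dvd r'"
    by (metis dvd_diff_commute diff_add_cancel dvd_add_right_iff)
  then show ?case by simp
next
  case (Suc T)
  from Suc.IH[of r r'] Suc.IH[of "r - 1" "r' - 1"] Suc.prems show ?case by simp
qed

lemma lacunary_binomial_symmetric: "lacunary_binomial L T (int T - r) = lacunary_binomial L T r"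
proof (induction T arbitrary: r)
  case 0
  show ?case by simp
next
  case (Suc T)
  have "lacunary_binomial L T (int (Suc T) - r) = lacunary_binomial L T (r - 1)"
    using Suc.IH[of "r - 1"] by (simp add: algebra_simps)
  moreover have "lacunary_binomial L T (int (Suc T) - r - 1) = lacunary_binomial L T r"
    using Suc.IH[of r] by (simp add: algebra_simps)
  ultimately show ?case by simp
qed

section \<open>Counting paths in a strip by reflection\<close>

text \<open>
  The reflection formula for the number of continuations by \<open>n\<close> further points of a path at level \<open>i\<close>
  that stays between \<open>0\<close> and \<open>L - 3\<close>. In terms of \<open>\<plusminus>1\<close> paths: having just climbed to \<open>i + 1\<close>, do \<open>n\<close> more
  up steps and \<open>n + i + 1\<close> down steps within \<open>0\<close> and \<open>L - 2\<close>. The forbidden levels \<open>-1\<close> and \<open>L - 1\<close> are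
  \<open>L\<close> apart, so shifting the path by twice this distance changes the number of down steps by \<open>L\<close>.
\<close>

definition strip_count :: "nat \<Rightarrow> nat \<Rightarrow> nat \<Rightarrow> int" where
  "strip_count L n i = lacunary_binomial L (2*n+i+1) (int (n+i+1)) - lacunary_binomial L (2*n+i+1) (int (n+i+2))"

lemma strip_count_Suc_Suc:
  "strip_count L (Suc n) (Suc i) = strip_count L (Suc n) i + strip_count L n (Suc (Suc i))"
proof -
  have 1: "2 * Suc n + Suc i + 1 = Suc (2*n+i+3)" "2 * Suc n + i + 1 = 2*n+i+3"
     "2 * n + Suc (Suc i) + 1 = 2*n+i+3" by simp_all
  have 2: "int (Suc n + Suc i + 1) - 1 = int (Suc n + i + 1)" "int (Suc n + Suc i + 1) = int (n + Suc (Suc i) + 1)"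
    "int (Suc n + Suc i + 2) - 1 = int (Suc n + i + 2)" "int (Suc n + Suc i + 2) = int (n + Suc (Suc i) + 2)"
    by simp_all
  show ?thesis unfolding strip_count_def 1 lacunary_binomial.simps by (simp only: 2) (simp add: algebra_simps)
qed

text \<open>
  Starting one up step earlier, at level \<open>0\<close>: the two sides differ by lacunary sums that agree by the
  symmetry of the odd row. This is the lower reflecting barrier.
\<close>

lemma strip_count_0_eq_lacunary_binomial:
  "strip_count L n 0 = lacunary_binomial L (2 * Suc n) (int (Suc n)) - lacunary_binomial L (2 * Suc n) (int (Suc n) + 1)"
proof -
  define r where "r = int n"
  have 3: "strip_count L n 0 = lacunary_binomial L (2*n+1) (r + 1) - lacunary_binomial L (2*n+1) (r + 2)"
    by (simp add: strip_count_def r_def algebra_simps del: lacunary_binomial.simps)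
  have 4: "lacunary_binomial L (2 * Suc n) x = lacunary_binomial L (2*n+1) x + lacunary_binomial L (2*n+1) (x - 1)" for x
    using lacunary_binomial.simps(2)[of L "2*n+1" x] by (simp del: lacunary_binomial.simps)
  have 5: "lacunary_binomial L (2*n+1) r = lacunary_binomial L (2*n+1) (r + 1)"
    using lacunary_binomial_symmetric[of L "2*n+1" "r + 1"] by (simp add: r_def algebra_simps del: lacunary_binomial.simps)
  have 6: "int (Suc n) = r + 1" "r + 1 + 1 = r + 2" "r + 2 - 1 = r + 1" "r + 1 - 1 = r"
    by (simp_all add: r_def)
  show ?thesis unfolding 4 6 using 3 5 by simp
qed

lemma strip_count_Suc_0:
  "strip_count L (Suc n) 0 = strip_count L n 0 + strip_count L n 1"
proof -
  define T where "T = 2 * Suc n"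
  define r where "r = int (Suc n)"
  have 1: "strip_count L (Suc n) 0 = lacunary_binomial L (Suc T) (r + 1) - lacunary_binomial L (Suc T) (r + 2)"
    by (simp add: strip_count_def T_def r_def algebra_simps del: lacunary_binomial.simps)
  have 2: "strip_count L n 1 = lacunary_binomial L T (r + 1) - lacunary_binomial L T (r + 2)"
    by (simp add: strip_count_def T_def r_def algebra_simps del: lacunary_binomial.simps)
  have 3: "strip_count L n 0 = lacunary_binomial L T r - lacunary_binomial L T (r + 1)"
    unfolding T_def r_def by (rule strip_count_0_eq_lacunary_binomial)
  have 4: "r + 1 - 1 = r" "r + 2 - 1 = r + 1"
    by simp_all
  show ?thesis
    unfolding 1 2 3 lacunary_binomial.simps 4 by simp
qed

text \<open>
  The upper barrier: at this level the reflection symmetry of the row, combined with a shift by one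
  period, exchanges the two lacunary sums.
\<close>

lemma strip_count_boundary: "strip_count (h + 3) n (h + 1) = 0"
proof -
  have "lacunary_binomial (h+3) (2*n+(h+1)+1) (int (n+(h+1)+1)) = lacunary_binomial (h+3) (2*n+(h+1)+1) (int (2*n+(h+1)+1) - int (n+(h+1)+1))"
    by (rule lacunary_binomial_symmetric[symmetric])
  also have "\<dots> = lacunary_binomial (h+3) (2*n+(h+1)+1) (int (n+(h+1)+2))"
    proof (rule lacunary_binomial_periodic)
    have "int (2*n+(h+1)+1) - int (n+(h+1)+1) - int (n+(h+1)+2) = - int (h+3)" by simp
    then show "int (h+3) dvd int (2*n+(h+1)+1) - int (n+(h+1)+1) - int (n+(h+1)+2)"
      by (simp only: dvd_minus_iff dvd_refl)
  qed
  finally show ?thesis by (simp add: strip_count_def)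
qed

text \<open>
  A row shorter than the period has at most one entry in each residue class.
\<close>

lemma lacunary_binomial_eq_binomial:
  assumes "T < L" "0 \<le> r" "r < int L"
  shows "lacunary_binomial L T r = int (T choose nat r)"
  using assms
proof (induction T arbitrary: r)
  case 0
  then show ?case
    by (cases "r = 0") (auto dest: zdvd_imp_le)
next
  case (Suc T)
  show ?case
  proof (cases "r = 0")
    case True
    have "lacunary_binomial L T (r - 1) = lacunary_binomial L T (int L - 1)"
      by (rule lacunary_binomial_periodic) (simp add: True)
    also have "\<dots> = 0"
      using Suc.IH[of "int L - 1"] Suc.prems by (simp add: binomial_eq_0)
    finally show ?thesis
      using Suc.IH[of r] Suc.prems True by simp
  next
    case False
    then have "nat r = Suc (nat (r - 1))"
      using Suc.prems by simp
    then show ?thesis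
      using Suc.IH[of r] Suc.IH[of "r - 1"] Suc.prems False by simp
  qed
qed

lemma strip_count_0: "i \<le> h \<Longrightarrow> strip_count (h + 3) 0 i = 1"
  by (simp add: strip_count_def lacunary_binomial_eq_binomial binomial_eq_0 nat_add_distrib del: lacunary_binomial.simps)

text \<open>
  This is the recursion of the path counts: from level \<open>i\<close> the next level is any of \<open>0, \<dots>, i + 1\<close>.
\<close>

lemma sum_strip_count: "(\<Sum>j\<le>Suc i. strip_count L n j) = strip_count L (Suc n) i"
proof (induction i)
  case 0
  show ?case using strip_count_Suc_0[of L n] by simp
next
  case (Suc i)
  then show ?case using strip_count_Suc_Suc[of L n i] by simp
qed

definition strip_walks :: "nat \<Rightarrow> nat \<Rightarrow> nat \<Rightarrow> int list set" where
  "strip_walks h n i = {js. length js = n \<and> (\<forall>j\<in>set js. j \<le> 1) \<and>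
     (\<forall>k\<le>n. 0 \<le> int i + path_level js k \<and> int i + path_level js k \<le> int h)}"

lemma path_level_0 [simp]: "path_level js 0 = 0"
  by (simp add: path_level_def)

lemma path_level_Cons_Suc [simp]: "path_level (j # js) (Suc k) = j + path_level js k"
  by (simp add: path_level_def)

lemma strip_walks_0: "i \<le> h \<Longrightarrow> strip_walks h 0 i = {[]}"
  by (auto simp: strip_walks_def)

lemma all_le_Suc: "(\<forall>k\<le>Suc n. P k) \<longleftrightarrow> P 0 \<and> (\<forall>k\<le>n. P (Suc k))"
  by (metis le0 Suc_le_mono not0_implies_Suc)

lemma strip_walks_Suc:
  assumes "i \<le> h"
  shows "strip_walks h (Suc n) i =
    (\<Union>l\<in>{..min (Suc i) h}. (\<lambda>js. (int l - int i) # js) ` strip_walks h n l)"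
    (is "?A = ?B")
proof
  show "?B \<subseteq> ?A"
    using assms by (auto simp: strip_walks_def all_le_Suc algebra_simps)
next
  show "?A \<subseteq> ?B"
  proof
    fix xs assume xs: "xs \<in> ?A"
    then obtain j js where eq: "xs = j # js"
      by (cases xs) (auto simp: strip_walks_def)
    from xs have *: "length js = n" "\<forall>x\<in>set js. x \<le> 1" "j \<le> 1"
      and lev: "0 \<le> int i + (j + path_level js k)" "int i + (j + path_level js k) \<le> int h"
      if "k \<le> n" for k
      using that unfolding eq by (auto simp: strip_walks_def all_le_Suc)
    define l where "l = nat (int i + j)"
    have l: "int l = int i + j" using lev(1)[of 0] by (simp add: l_def)
    have "l \<le> min (Suc i) h" using lev(2)[of 0] l *(3)[of 0] by simp
    moreover have "js \<in> strip_walks h n l"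
      using * lev by (auto simp: strip_walks_def l algebra_simps)
    moreover have "xs = (int l - int i) # js" by (simp add: eq l)
    ultimately show "xs \<in> ?B" by blast
  qed
qed

lemma finite_strip_walks: "i \<le> h \<Longrightarrow> finite (strip_walks h n i)"
proof (induction n arbitrary: i)
  case (Suc n)
  then show ?case by (simp add: strip_walks_Suc)
qed (simp add: strip_walks_0)

lemma card_strip_walks:
  "i \<le> h \<Longrightarrow> int (card (strip_walks h n i)) = strip_count (h + 3) n i"
proof (induction n arbitrary: i)
  case 0
  then show ?case by (simp add: strip_walks_0 strip_count_0)
next
  case (Suc n)
  have "card (strip_walks h (Suc n) i) =
      (\<Sum>l\<le>min (Suc i) h. card ((\<lambda>js. (int l - int i) # js) ` strip_walks h n l))"
    unfolding strip_walks_Suc[OF Suc.prems]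
    by (rule card_UN_disjoint) (auto simp: finite_strip_walks)
  also have "\<dots> = (\<Sum>l\<le>min (Suc i) h. card (strip_walks h n l))"
    by (intro sum.cong refl card_image) (simp add: inj_on_def)
  finally have "int (card (strip_walks h (Suc n) i)) = (\<Sum>l\<le>min (Suc i) h. strip_count (h + 3) n l)"
    using Suc.IH by (simp add: Suc.IH)
  \<comment> \<open>From the top level the step to \<open>h + 1\<close> is forbidden, but its formal count is \<open>0\<close>.\<close>
  also have "\<dots> = (\<Sum>l\<le>Suc i. strip_count (h + 3) n l)"
  proof (cases "i < h")
    case False
    with Suc.prems have "i = h" by simp
    then show ?thesis using strip_count_boundary[of h n] by simp
  qed (simp add: min_def)
  finally show ?case by (simp only: sum_strip_count)
qed

lemma path_height_le_iff: "path_height js \<le> x \<longleftrightarrow> (\<forall>k\<le>length js. path_level js k \<le> x)"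
  unfolding path_height_def by (subst Max_le_iff) auto

lemma path_height_ge: "k \<le> length js \<Longrightarrow> path_level js k \<le> path_height js"
  using path_height_le_iff[of js "path_height js"] by simp

lemma card_height_le: "int (card {js \<in> partial_lukasiewicz_rl n. path_height js \<le> int h}) = strip_count (h + 3) n 0"
proof -
  have "{js \<in> partial_lukasiewicz_rl n. path_height js \<le> int h} = strip_walks h n 0"
    by (auto simp: strip_walks_def partial_lukasiewicz_rl_def path_height_le_iff)
  then show ?thesis by (simp add: card_strip_walks)
qed

lemma path_height_bounds:
  assumes "js \<in> partial_lukasiewicz_rl n"
  shows "0 \<le> path_height js" "path_height js \<le> int n"
proof -
  show "0 \<le> path_height js" using path_height_ge[of 0 js] by simp
  have "path_level js k \<le> int k" if "k \<le> length js" for k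
  proof -
    have "sum_list (take k js) \<le> sum_list (map (\<lambda>_. 1) (take k js))"
      using assms set_take_subset[of k js] sum_list_mono[of "take k js" "\<lambda>x. x" "\<lambda>_. 1"]
      by (force simp: partial_lukasiewicz_rl_def)
    then show ?thesis using that by (simp add: path_level_def sum_list_triv min_def split: if_splits)
  qed
  then show "path_height js \<le> int n"
    using assms by (fastforce simp: path_height_le_iff partial_lukasiewicz_rl_def)
qed

lemma card_partial_lukasiewicz_rl:
  "int (card (partial_lukasiewicz_rl n)) = strip_count (n + 3) n 0"
proof -
  have "{js \<in> partial_lukasiewicz_rl n. path_height js \<le> int n} = partial_lukasiewicz_rl n"
    using path_height_bounds(2) by blast
  then show ?thesis using card_height_le[of n n] by simp
qed

lemma sum_path_height:
  "(\<Sum>js\<in>partial_lukasiewicz_rl n. path_height js) =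
     (\<Sum>h<n. int (card (partial_lukasiewicz_rl n)) - strip_count (h + 3) n 0)"
proof -
  let ?P = "partial_lukasiewicz_rl n"
  have "path_height js = (\<Sum>h<n. if path_height js \<le> int h then 0 else 1)"
    if js: "js \<in> ?P" for js
  proof -
    obtain t where t: "path_height js = int t" "t \<le> n"
      using path_height_bounds[OF js] by (metis nonneg_int_cases of_nat_le_iff)
    have "(\<Sum>h<n. if t \<le> h then 0 else 1 :: int) = int (card ({..<n} \<inter> - {h. t \<le> h}))"
      by (simp add: sum.If_cases)
    also have "{..<n} \<inter> - {h. t \<le> h} = {..<t}"
      using t by auto
    finally show ?thesis using t by simp
  qed
  then have "(\<Sum>js\<in>?P. path_height js) = (\<Sum>js\<in>?P. \<Sum>h<n. if path_height js \<le> int h then 0 else 1)"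
    by (intro sum.cong) auto
  also have "\<dots> = (\<Sum>h<n. \<Sum>js\<in>?P. if path_height js \<le> int h then 0 else 1)"
    by (rule sum.swap)
  also have "\<dots> = (\<Sum>h<n. int (card ?P) - strip_count (h + 3) n 0)"
  proof (intro sum.cong refl)
    fix h
    have "(\<Sum>js\<in>?P. if path_height js \<le> int h then 0 else 1 :: int) =
        (\<Sum>js\<in>?P. 1 - (if path_height js \<le> int h then 1 else 0))"
      by (intro sum.cong) auto
    also have "\<dots> = int (card ?P) - int (card {js \<in> ?P. path_height js \<le> int h})"
      by (simp add: sum_subtractf sum.inter_filter[symmetric] finite_partial_lukasiewicz_rl)
    finally show "(\<Sum>js\<in>?P. if path_height js \<le> int h then 0 else 1 :: int) =
        int (card ?P) - strip_count (h + 3) n 0"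
      by (simp add: card_height_le)
  qed
  finally show ?thesis .
qed

section \<open>The total height as a divisor sum\<close>

text \<open>
  Binomial coefficients extended by zero to negative lower arguments, so that Pascal's rule and the
  symmetry hold for every integer.
\<close>

definition int_binomial :: "nat \<Rightarrow> int \<Rightarrow> int" where
  "int_binomial T j = (if j < 0 then 0 else int (T choose nat j))"

lemma int_binomial_Suc: "int_binomial (Suc T) j = int_binomial T j + int_binomial T (j - 1)"
proof (cases "j \<le> 0")
  case True
  then show ?thesis by (auto simp: int_binomial_def)
next
  case False
  then have "nat j = Suc (nat (j - 1))" by simp
  with False show ?thesis by (simp add: int_binomial_def)
qed

lemma int_binomial_symmetric: "int_binomial T (int T - j) = int_binomial T j"
proof (cases "0 \<le> j \<and> j \<le> int T")
  case True
  then have "nat (int T - j) = T - nat j" by (simp add: nat_diff_distrib)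
  with True binomial_symmetric[of "nat j" T] show ?thesis by (simp add: int_binomial_def nat_le_iff)
qed (auto simp: int_binomial_def binomial_eq_0)

text \<open>
  The two hypotheses make the window of half-width \<open>B\<close> around \<open>r\<close> cover the whole row \<open>0, \<dots>, T\<close>.
\<close>

lemma lacunary_binomial_eq_sum:
  assumes "r \<le> B" "int T - r \<le> B"
  shows "lacunary_binomial L T r = (\<Sum>m\<in>{-B..B}. if int L dvd m then int_binomial T (r + m) else 0)"
  using assms
proof (induction T arbitrary: r)
  case 0
  have "(\<Sum>m\<in>{-B..B}. if int L dvd m then int_binomial 0 (r + m) else 0) =
      (\<Sum>m\<in>{-B..B}. if m = -r then (if int L dvd r then 1 else 0) else 0)"
    by (intro sum.cong) (auto simp: int_binomial_def)
  also have "\<dots> = (if int L dvd r then 1 else 0)"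
    using 0 by (subst sum.delta) auto
  finally show ?case by simp
next
  case (Suc T)
  then show ?case
    by (auto simp: int_binomial_Suc sum.distrib[symmetric] algebra_simps intro!: sum.cong)
qed

definition catalan_real :: "nat \<Rightarrow> real" where
  "catalan_real N = real (2 * N choose N) - real (2 * N choose (N + 1))"

definition binom_diff2 :: "nat \<Rightarrow> nat \<Rightarrow> real" where
  "binom_diff2 N m = real (2 * N choose (N + m + 1)) - 2 * real (2 * N choose (N + m))
     + real (2 * N choose (N + m - 1))"

lemma sum_even_int:
  fixes F :: "int \<Rightarrow> 'a::comm_ring_1"
  assumes "\<And>m. F (- m) = F m"
  shows "(\<Sum>m\<in>{- int B..int B}. F m) = F 0 + 2 * (\<Sum>m=1..B. F (int m))"
proof (induction B)
  case (Suc B)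
  have "{- int (Suc B)..int (Suc B)} = insert (int (Suc B)) (insert (- int (Suc B)) {- int B..int B})"
    by auto
  then show ?case using Suc assms[of "int (Suc B)"] by (simp add: algebra_simps)
qed simp

text \<open>
  By symmetry of the even row, the difference of two lacunary sums is minus half of a second difference in
  the residue. Termwise it becomes a sum of second differences over all multiples of \<open>L\<close>, which is even in
  the multiple; the multiple \<open>0\<close> contributes the Catalan number.
\<close>

lemma strip_count_0_eq_sum:
  "real_of_int (strip_count L n 0) =
     catalan_real (Suc n) - (\<Sum>m=1..n+2. if L dvd m then binom_diff2 (Suc n) m else 0)"
proof -
  define N where "N = Suc n"
  define W where "W m = int_binomial (2*N) (int N + 1 + m) - 2 * int_binomial (2*N) (int N + m) + int_binomial (2*N) (int N - 1 + m)" for m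
  define F where "F m = (if int L dvd m then W m else 0)" for m
  have W_even: "W (- m) = W m" for m
    using int_binomial_symmetric[of "2*N" "int N + 1 + m"] int_binomial_symmetric[of "2*N" "int N + m"]
      int_binomial_symmetric[of "2*N" "int N - 1 + m"]
    by (simp add: W_def algebra_simps)
  have sym: "lacunary_binomial L (2*N) (int N + 1) = lacunary_binomial L (2*N) (int N - 1)"
    using lacunary_binomial_symmetric[of L "2*N" "int N - 1"] by (simp add: algebra_simps del: lacunary_binomial.simps)
  have "- 2 * strip_count L n 0 = lacunary_binomial L (2*N) (int N + 1) - 2 * lacunary_binomial L (2*N) (int N) + lacunary_binomial L (2*N) (int N - 1)"
    using sym by (simp add: strip_count_0_eq_lacunary_binomial N_def del: lacunary_binomial.simps)
  also have "\<dots> = (\<Sum>m\<in>{-int (N+1)..int (N+1)}. F m)"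
    by (subst (1 2 3) lacunary_binomial_eq_sum[where B = "int (N+1)"])
      (auto simp: F_def W_def sum.distrib[symmetric] sum_subtractf[symmetric] sum_distrib_left intro!: sum.cong)
  also have "\<dots> = F 0 + 2 * (\<Sum>m=1..N+1. F (int m))"
    by (rule sum_even_int) (simp add: F_def W_even)
  also have "F 0 = 2 * (int_binomial (2*N) (int N + 1) - int_binomial (2*N) (int N))"
    using int_binomial_symmetric[of "2*N" "int N + 1"] by (simp add: F_def W_def algebra_simps)
  finally have *: "strip_count L n 0 = int_binomial (2*N) (int N) - int_binomial (2*N) (int N + 1) - (\<Sum>m=1..N+1. F (int m))"
    by simp
  have 1: "real_of_int (F (int m)) = (if L dvd m then binom_diff2 N m else 0)" if "m \<in> {1..N+1}" for m
  proof -
    have "nat (int N + 1 + int m) = N + m + 1" "nat (int N + int m) = N + m" "nat (int N - 1 + int m) = N + m - 1"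
      using that by auto
    then show ?thesis using that by (simp add: F_def W_def binom_diff2_def int_binomial_def)
  qed
  have 2: "real_of_int (\<Sum>m=1..N+1. F (int m)) = (\<Sum>m=1..N+1. if L dvd m then binom_diff2 N m else 0)"
    unfolding of_int_sum by (intro sum.cong refl 1)
  have 3: "real_of_int (int_binomial (2*N) (int N) - int_binomial (2*N) (int N + 1)) = catalan_real N"
    by (simp add: int_binomial_def catalan_real_def nat_add_distrib)
  show ?thesis
    unfolding * of_int_diff[of _ "\<Sum>m=1..N+1. F (int m)"] 2 3 unfolding N_def by simp
qed

lemma lacunary_binomial_1: "lacunary_binomial 1 T r = lacunary_binomial 1 T r'"
  by (rule lacunary_binomial_periodic) simp

lemma lacunary_binomial_2: "lacunary_binomial 2 (Suc T) (r + 1) = lacunary_binomial 2 (Suc T) r"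
  using lacunary_binomial_periodic[of 2 "r + 1" "r - 1" T] by simp

text \<open>
  The moduli \<open>1\<close> and \<open>2\<close> would belong to strips of height \<open>-2\<close> and \<open>-1\<close>, which contain no path. Thanks to
  these two values the sum over the moduli \<open>L \<ge> 3\<close> can be completed to a sum over all divisors.
\<close>

lemma strip_count_degenerate:
  assumes "L = 1 \<or> L = 2"
  shows "strip_count L n 0 = 0"
  using assms lacunary_binomial_1[of "2 * Suc n" "int (Suc n)" "int (Suc n) + 1"] lacunary_binomial_2[of "Suc (2*n)" "int (Suc n)"]
  unfolding strip_count_0_eq_lacunary_binomial by (auto simp del: lacunary_binomial.simps)

lemma real_card_partial_lukasiewicz_rl: "real (card (partial_lukasiewicz_rl n)) = catalan_real (Suc n)"
proof -
  have "(\<Sum>m=1..n+2. if n + 3 dvd m then binom_diff2 (Suc n) m else 0) = 0"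
    by (intro sum.neutral ballI) (auto dest: dvd_imp_le)
  then show ?thesis
    using card_partial_lukasiewicz_rl[of n] strip_count_0_eq_sum[of "n + 3" n] by simp
qed

lemma sum_path_height_eq_divisor_sum:
  "(\<Sum>js\<in>partial_lukasiewicz_rl n. real_of_int (path_height js)) =
     (\<Sum>m=1..n+2. real (card {L. L dvd m}) * binom_diff2 (Suc n) m) - 2 * catalan_real (Suc n)"
proof -
  define S where "S L = catalan_real (Suc n) - real_of_int (strip_count L n 0)" for L
  have S: "S L = (\<Sum>m=1..n+2. if L dvd m then binom_diff2 (Suc n) m else 0)" for L
    by (simp only: S_def strip_count_0_eq_sum diff_diff_eq2 add_diff_cancel_left')
  have "(\<Sum>js\<in>partial_lukasiewicz_rl n. real_of_int (path_height js)) = (\<Sum>h<n. S (h + 3))"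
    unfolding of_int_sum[symmetric] sum_path_height S_def of_int_diff
    by (simp add: real_card_partial_lukasiewicz_rl)
  also have "\<dots> = (\<Sum>L=1..n+2. S L) - 2 * catalan_real (Suc n)"
  proof -
    have "S 1 = catalan_real (Suc n)" "S 2 = catalan_real (Suc n)"
      by (simp_all add: S_def strip_count_degenerate)
    moreover
    have "(\<Sum>h<n. S (h + 3)) = (\<Sum>L\<in>{3..n+2}. S L)"
      by (rule sum.reindex_bij_witness[of _ "\<lambda>L. L - 3" "\<lambda>h. h + 3"]) auto
    moreover have "{1..n+2} = insert 1 (insert 2 {3..n+2})" by auto
    ultimately show ?thesis by simp
  qed
  also have "(\<Sum>L=1..n+2. S L) = (\<Sum>m=1..n+2. \<Sum>L=1..n+2. if L dvd m then binom_diff2 (Suc n) m else 0)"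
    unfolding S by (rule sum.swap)
  also have "\<dots> = (\<Sum>m=1..n+2. real (card {L. L dvd m}) * binom_diff2 (Suc n) m)"
  proof (intro sum.cong refl)
    fix m assume m: "m \<in> {1..n+2}"
    have "L \<in> {1..n+2}" if "L dvd m" for L
      using m that dvd_imp_le[OF that] dvd_pos_nat[OF _ that] by simp
    then have "{1..n+2} \<inter> {L. L dvd m} = {L. L dvd m}"
      by auto
    then show "(\<Sum>L=1..n+2. if L dvd m then binom_diff2 (Suc n) m else 0) =
        real (card {L. L dvd m}) * binom_diff2 (Suc n) m"
      by (simp only: sum.If_cases[OF finite_atLeastAtMost] sum_constant sum.neutral_const add_0_right)
  qed
  finally show ?thesis by simp
qed

section \<open>Dirichlet's divisor estimate\<close>

lemma harm_approx:
  assumes "n \<ge> 1"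
  shows "\<bar>harm n - ln (real n) - euler_mascheroni\<bar> \<le> 1 / real n"
proof -
  define t where "t = harm n - ln (real (Suc n)) "
  have 1: "euler_mascheroni \<in> {t + inverse (real (2*(n+1)))..t + inverse (real (2*n))}"
    unfolding t_def using euler_mascheroni_bounds[OF assms] by simp
  have 2: "inverse (real (2*(n+1))) \<ge> 0" "inverse (real (2*n)) \<le> 1 / real n"
    using assms by (auto simp: field_simps)
  have 3: "ln (real (Suc n)) - ln (real n) \<le> 1 / real n" "ln (real n) \<le> ln (real (Suc n))"
    using ln_diff_le[of "real (Suc n)" "real n"] assms by simp_all
  show ?thesis using 1 2 3 unfolding t_def abs_le_iff atLeastAtMost_iff by linarith
qed

lemma harm_le: "harm n \<le> ln (real n) + 2" if "n \<ge> 1"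
proof -
  have "1 / real n \<le> 1" using that by simp
  then show ?thesis
    using harm_approx[OF that] euler_mascheroni_less_13_over_22 by linarith
qed

text \<open>
  The mean of \<open>d\<close> is compared with \<open>harm j + \<gamma>\<close> rather than with \<open>ln j + 2 \<gamma>\<close> because harmonic numbers have
  the exact differences \<open>1/j\<close>, which makes the later summation by parts exact.
\<close>

lemma sum_harm: "(\<Sum>j=1..m. harm j :: real) = (real m + 1) * harm m - real m"
proof (induction m)
  case (Suc m)
  have "real (Suc m) * harm (Suc m) = real (Suc m) * harm m + 1"
    by (simp add: harm_Suc distrib_left del: of_nat_Suc)
  with Suc show ?case by (simp add: algebra_simps)
qed (simp add: harm_expand)

lemma sum_card_divisors:
  "(\<Sum>j=1..m. card {L. L dvd j}) = card {(a, b). 1 \<le> a \<and> 1 \<le> b \<and> a * b \<le> (m::nat)}"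
proof -
  have "card {L. L dvd j} = card {(a, b). a * b = j}" if "1 \<le> j" for j :: nat
  proof (rule bij_betw_same_card)
    show "bij_betw (\<lambda>a. (a, j div a)) {L. L dvd j} {(a, b). a * b = j}"
      by (rule bij_betw_byWitness[of _ fst]) (use that in auto)
  qed
  then have "(\<Sum>j=1..m. card {L. L dvd j}) = (\<Sum>j=1..m. card {(a, b). a * b = j})"
    by simp
  also have "\<dots> = card (\<Union>j\<in>{1..m}. {(a, b). a * b = j})"
  proof (rule card_UN_disjoint[symmetric])
    have "finite {(a, b). a * b = j}" if "1 \<le> j" for j :: nat
      by (rule finite_subset[of _ "{..j} \<times> {..j}"]) (use that in auto)
    then show "\<forall>j\<in>{1..m}. finite {(a, b). a * b = j}" by simp
  qed auto
  also have "(\<Union>j\<in>{1..m}. {(a, b). a * b = j}) = {(a, b). 1 \<le> a \<and> 1 \<le> b \<and> a * b \<le> m}"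
    by (auto simp: Suc_le_eq)
  finally show ?thesis .
qed

text \<open>
  A pair with product at most \<open>m\<close> has a component at most \<open>s = \<lfloor>sqrt m\<rfloor>\<close>. Both ways of bounding a component
  give the same count, and the pairs counted twice form the full square of side \<open>s\<close>.
\<close>

lemma hyperbola_count:
  fixes m s :: nat
  assumes "s\<^sup>2 \<le> m" "m < (s + 1)\<^sup>2"
  shows "card {(a, b). 1 \<le> a \<and> 1 \<le> b \<and> a * b \<le> m} + s\<^sup>2 = 2 * (\<Sum>a=1..s. m div a)"
proof -
  define P where "P = (SIGMA a:{1..s}. {1..m div a})"
  define Q where "Q = prod.swap ` P"
  have P: "(a, b) \<in> P \<longleftrightarrow> 1 \<le> a \<and> 1 \<le> b \<and> a * b \<le> m \<and> a \<le> s" for a b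
    by (auto simp: P_def less_eq_div_iff_mult_less_eq mult.commute)
  have Q: "(a, b) \<in> Q \<longleftrightarrow> 1 \<le> a \<and> 1 \<le> b \<and> a * b \<le> m \<and> b \<le> s" for a b
    by (auto simp: Q_def P image_iff Bex_def mult.commute)
  have fin: "finite P" "finite Q" by (simp_all add: P_def Q_def)
  have "card P = (\<Sum>a=1..s. m div a)" by (simp add: P_def)
  moreover have "card Q = card P" unfolding Q_def by (rule card_image) simp
  moreover have "P \<union> Q = {(a, b). 1 \<le> a \<and> 1 \<le> b \<and> a * b \<le> m}"
  proof -
    have "a \<le> s \<or> b \<le> s" if "a * b \<le> m" for a b :: nat
    proof (rule ccontr)
      assume "\<not> ?thesis"
      then have "(s + 1) * (s + 1) \<le> a * b" by (intro mult_mono) auto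
      with that assms show False by (simp add: power2_eq_square)
    qed
    then show ?thesis unfolding set_eq_iff by (auto simp: P Q)
  qed
  moreover have "P \<inter> Q = {1..s} \<times> {1..s}"
  proof -
    have "a * b \<le> m" if "a \<le> s" "b \<le> s" for a b
      using mult_mono[OF that] assms by (simp add: power2_eq_square)
    then show ?thesis by (auto simp: P Q)
  qed
  ultimately show ?thesis
    using card_Un_Int[OF fin] by (simp add: power2_eq_square)
qed

text \<open>
  With \<open>x = m\<close> and \<open>y = \<lfloor>sqrt m\<rfloor>\<close>, dropping the floors in the hyperbola count gives \<open>2 x H(y) - y^2\<close> up to
  \<open>O(y)\<close>. Both this and the comparison sum are \<open>x ln x + (2 \<gamma> - 1) x + O(y)\<close>, since \<open>x\<close> and \<open>y^2\<close> differ by at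
  most \<open>2 y\<close>. The constant \<open>40\<close> is generous.
\<close>

lemma dirichlet_divisor_error:
  shows "\<bar>\<Sum>j=1..m. real (card {L. L dvd j}) - (harm j + euler_mascheroni)\<bar> \<le> 40 * sqrt (real m)"
proof (cases "m = 0")
  case False
  define s where "s = floor_sqrt m"
  have s: "s\<^sup>2 \<le> m" "m < (s + 1)\<^sup>2"
    using Suc_floor_sqrt_power2_gt[of m] by (simp_all add: s_def)
  have s1: "s \<ge> 1" using False s_def by (simp add: Suc_le_eq)
  define x where "x = real m"
  define y where "y = real s"
  define g :: real where "g = euler_mascheroni"
  have y1: "y \<ge> 1" using s1 by (simp add: y_def)
  have xl: "y\<^sup>2 \<le> x" using s(1) by (simp add: x_def y_def flip: of_nat_power)
  have xu: "x \<le> y\<^sup>2 + 2 * y"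
  proof -
    have "m \<le> s\<^sup>2 + 2 * s" using s(2) by (simp add: power2_eq_square)
    then have "real m \<le> real (s\<^sup>2 + 2 * s)" by (rule of_nat_mono)
    then show ?thesis by (simp add: x_def y_def)
  qed
  have xpos: "x \<ge> 1" using y1 xl by (smt (verit) one_le_power)
  define D where "D = (\<Sum>j=1..m. real (card {L. L dvd j}))"
  define F where "F = (\<Sum>a=1..s. real (m div a))"
  have "real (card {(a, b). 1 \<le> a \<and> 1 \<le> b \<and> a * b \<le> m} + s\<^sup>2) = real (2 * (\<Sum>a=1..s. m div a))"
    using hyperbola_count[OF s] by simp
  then have D: "D = 2 * F - y\<^sup>2"
    unfolding D_def F_def y_def of_nat_sum[symmetric] sum_card_divisors by simp
  have F: "x * harm s - y \<le> F" "F \<le> x * harm s"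
  proof -
    have 1: "x / real a - 1 \<le> real (m div a)" "real (m div a) \<le> x / real a" if "a \<in> {1..s}" for a
    proof -
      show "real (m div a) \<le> x / real a" by (simp add: x_def of_nat_div_le_of_nat)
      have "m < a * (m div a) + a" using that
        by (metis One_nat_def Suc_le_lessD atLeastAtMost_iff mod_less_divisor mult_div_mod_eq nat_add_left_cancel_less)
      then have "real m < real (a * (m div a) + a)" by (rule of_nat_less_iff[THEN iffD2])
      then show "x / real a - 1 \<le> real (m div a)" using that by (simp add: x_def field_simps)
    qed
    have 2: "(\<Sum>a=1..s. x / real a) = x * harm s" 
      by (simp add: harm_def sum_distrib_left divide_inverse)
    have "(\<Sum>a=1..s. x / real a - 1) \<le> F" "F \<le> (\<Sum>a=1..s. x / real a)"
      unfolding F_def by (intro sum_mono 1; assumption)+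
    then show "x * harm s - y \<le> F" "F \<le> x * harm s"
      by (simp_all add: sum_subtractf 2[simplified] y_def)
  qed
  have lnx: "2 * ln y \<le> ln x" "ln x \<le> 2 * ln y + 2 / y"
  proof -
    have *: "2 * ln y = ln (y\<^sup>2)" using y1 by (simp add: ln_realpow)
    show "2 * ln y \<le> ln x" unfolding * using xl y1 xpos by simp
    have "ln x - ln (y\<^sup>2) \<le> (x - y\<^sup>2) / y\<^sup>2" using xpos y1 by (intro ln_diff_le) auto
    also have "\<dots> \<le> (2 * y) / y\<^sup>2" using xu by (intro divide_right_mono) auto
    also have "\<dots> = 2 / y" by (simp add: power2_eq_square)
    finally show "ln x \<le> 2 * ln y + 2 / y" by (simp add: *)
  qed
  have hs: "\<bar>harm s - ln y - g\<bar> \<le> 1 / y" using harm_approx[OF s1] by (simp add: y_def g_def)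
  have hm: "\<bar>harm m - ln x - g\<bar> \<le> 1 / x" using harm_approx[of m] False by (simp add: x_def g_def)
  have xy: "x / y \<le> y + 2" using xu y1 by (simp add: divide_simps power2_eq_square algebra_simps)
  have e1: "\<bar>x * harm s - x * ln y - x * g\<bar> \<le> y + 2"
  proof -
    have "\<bar>x * (harm s - ln y - g)\<bar> \<le> x * (1 / y)" using mult_left_mono[OF hs, of x] xpos by (simp add: abs_mult)
    then show ?thesis using xy by (simp add: algebra_simps)
  qed
  have e2: "\<bar>x * harm m - x * ln x - x * g\<bar> \<le> 1"
  proof -
    have "\<bar>x * (harm m - ln x - g)\<bar> \<le> x * (1 / x)" using mult_left_mono[OF hm, of x] xpos by (simp add: abs_mult)
    then show ?thesis using xpos by (simp add: algebra_simps)
  qed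
  have e3: "2 * (x * ln y) \<le> x * ln x" "x * ln x \<le> 2 * (x * ln y) + 2 * (y + 2)"
  proof -
    show "2 * (x * ln y) \<le> x * ln x" using mult_left_mono[OF lnx(1), of x] xpos by simp
    have "x * ln x \<le> x * (2 * ln y + 2 / y)" using mult_left_mono[OF lnx(2), of x] xpos by simp
    also have "\<dots> = 2 * (x * ln y) + 2 * (x / y)" by (simp add: algebra_simps)
    also have "\<dots> \<le> 2 * (x * ln y) + 2 * (y + 2)"
      by (intro add_left_mono mult_left_mono xy) simp
    finally show "x * ln x \<le> 2 * (x * ln y) + 2 * (y + 2)" .
  qed
  have e4: "harm m \<le> 2 * y + 4" "0 \<le> (harm m :: real)"
  proof -
    have "ln y \<le> y - 1" using y1 by (intro ln_le_minus_one) simp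
    moreover have "2 / y \<le> 2" "1 / x \<le> 1" using y1 xpos by (simp_all add: divide_simps)
    moreover have "g \<le> 1" using euler_mascheroni_less_13_over_22 by (simp add: g_def)
    ultimately show "harm m \<le> 2 * y + 4" using hm lnx(2) by linarith
  qed (simp add: harm_nonneg)
  have "(\<Sum>j=1..m. real (card {L. L dvd j}) - (harm j + euler_mascheroni)) = D - ((x + 1) * harm m - x + x * g)"
    by (simp only: sum_subtractf sum.distrib sum_harm D_def x_def g_def) simp
  also have "\<bar>\<dots>\<bar> \<le> 40 * y"
    using D F e1 e2 e3 e4 xl xu y1 unfolding abs_le_iff by (simp add: algebra_simps)
  also have "y \<le> sqrt x" using xl y1 by (simp add: real_le_rsqrt)
  finally show ?thesis by (simp add: x_def)
qed simp

section \<open>Differences of the central binomial row\<close>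

lemma binomial_absorb_real:
  "(real n + 1 - real k) * real (Suc n choose k) = (real n + 1) * real (n choose k)"
proof (cases "k \<le> Suc n")
  case True
  have "real ((Suc n - k) * (Suc n choose k)) = real (Suc n * (n choose k))"
    using binomial_absorb_comp[of "Suc n" k] by simp
  with True show ?thesis by (simp only: of_nat_mult of_nat_diff of_nat_Suc) (simp add: algebra_simps)
qed (simp add: binomial_eq_0)

lemma binomial_absorb_real':
  "(real k + 1) * real (Suc n choose Suc k) = (real n + 1) * real (n choose k)"
proof -
  have "real (Suc k * (Suc n choose Suc k)) = real (Suc n * (n choose k))"
    by (simp only: Suc_times_binomial_eq mult.commute)
  then show ?thesis by (simp only: of_nat_mult of_nat_Suc add.commute)
qed

lemma catalan_real_eq: "catalan_real N = real (2 * N choose N) / (real N + 1)"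
proof (cases N)
  case (Suc n)
  have "2 * N = Suc (2 * n + 1)" by (simp add: Suc)
  then have "(real N + 1) * real (2 * N choose Suc N) = real N * real (2 * N choose N)"
    using binomial_absorb_real'[of N "2 * n + 1"] binomial_absorb_real[of "2 * n + 1" N] Suc by simp
  then show ?thesis by (simp add: catalan_real_def field_simps)
qed (simp add: catalan_real_def)

definition binom_diff1 :: "nat \<Rightarrow> nat \<Rightarrow> real" where
  "binom_diff1 N m = real (2 * N choose (N + m - 1)) - real (2 * N choose (N + m))"

lemma binom_diff2_eq_diff: "binom_diff2 N m = binom_diff1 N m - binom_diff1 N (Suc m)"
  by (simp add: binom_diff1_def binom_diff2_def)

lemma binom_diff1_eq:
  assumes "1 \<le> m"
  shows "(2 * real N + 1) * binom_diff1 N m = (2 * real m - 1) * real (Suc (2 * N) choose (N + m))"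
proof -
  have "Suc (N + m - 1) = N + m" "real (N + m - 1) + 1 = real N + real m" using assms by simp_all
  then show ?thesis
    using binomial_absorb_real[of "2*N" "N + m"] binomial_absorb_real'[of "N + m - 1" "2*N"]
    by (simp add: binom_diff1_def algebra_simps del: binomial_Suc_Suc)
qed

text \<open>
  Passing to the row \<open>2 M = 2 N + 2\<close> avoids denominators such as \<open>M^2 - m^2\<close>, which would vanish at the end of the
  row. By Pascal's rule the second difference is \<open>(2M choose M + m) - 4 (2N choose N + m)\<close>, and the
  second coefficient is \<open>(M^2 - m^2) / (2 M (2 M - 1))\<close> times the first.
\<close>

lemma binom_diff2_eq:
  assumes "1 \<le> m" "M = Suc N"
  shows "real M * (2 * real M - 1) * binom_diff2 N m = (2 * real m ^ 2 - real M) * real (2 * M choose (M + m))"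
proof -
  define c where "c = real (2 * M choose (M + m))"
  define d where "d = real (2 * N choose (N + m))"
  define x where "x = real (Suc (2 * N) choose (N + m))"
  obtain k where k: "m = Suc k" using assms by (cases m) auto
  have 1: "binom_diff2 N m = c - 4 * d"
    by (simp add: c_def d_def binom_diff2_def assms k numeral_2_eq_2)
  have "2 * M = Suc (Suc (2 * N))" "M + m = Suc (N + m)" by (simp_all add: assms)
  then have 2: "(real M + real m) * c = 2 * real M * x"
    using binomial_absorb_real'[of "N + m" "Suc (2 * N)"] assms(2)
    by (simp add: c_def x_def algebra_simps del: binomial_Suc_Suc)
  have 3: "(real M - real m) * x = (2 * real M - 1) * d"
    using binomial_absorb_real[of "2 * N" "N + m"] assms(2)
    by (simp add: d_def x_def algebra_simps del: binomial_Suc_Suc)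
  have "2 * real M * ((2 * real M - 1) * d) = (real M - real m) * (2 * real M * x)"
    unfolding 3[symmetric] by (simp add: algebra_simps)
  then have "2 * real M * ((2 * real M - 1) * d) = (real M - real m) * ((real M + real m) * c)"
    unfolding 2 .
  then show ?thesis
    unfolding 1 c_def[symmetric] by (simp add: algebra_simps power2_eq_square)
qed

lemma binom_diff3_eq:
  assumes "1 \<le> m" "M = Suc N"
  shows "real M * (2 * real M - 1) * (2 * real M + 1) * (binom_diff2 N m - binom_diff2 N (Suc m)) =
    (2 * real m + 1) * (2 * real m * (real m + 1) - 3 * real M) * real (Suc (2 * M) choose (M + Suc m))"
proof -
  define x where "x = real (Suc (2 * M) choose (M + Suc m))"
  have 1: "(2 * real M + 1) * real (2 * M choose (M + m)) = (real M + real m + 1) * x"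
    using binomial_absorb_real'[of "M + m" "2 * M"] by (simp add: x_def algebra_simps del: binomial_Suc_Suc)
  have 2: "(2 * real M + 1) * real (2 * M choose (M + Suc m)) = (real M - real m) * x"
    using binomial_absorb_real[of "2 * M" "M + Suc m"] by (simp add: x_def algebra_simps del: binomial_Suc_Suc)
  have "real M * (2 * real M - 1) * (2 * real M + 1) * (binom_diff2 N m - binom_diff2 N (Suc m)) =
      (2 * real M + 1) * (real M * (2 * real M - 1) * binom_diff2 N m) -
      (2 * real M + 1) * (real M * (2 * real M - 1) * binom_diff2 N (Suc m))"
    by (simp add: algebra_simps)
  also have "\<dots> = (2 * real m ^ 2 - real M) * ((2 * real M + 1) * real (2 * M choose (M + m)))
      - (2 * real (Suc m) ^ 2 - real M) * ((2 * real M + 1) * real (2 * M choose (M + Suc m)))"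
    unfolding binom_diff2_eq[OF assms] binom_diff2_eq[OF le_SucI[OF assms(1)] assms(2)]
    by (simp only: mult.left_commute)
  also have "\<dots> = (2 * real m + 1) * (2 * real m * (real m + 1) - 3 * real M) * x"
    unfolding 1 2 by (simp add: algebra_simps power2_eq_square)
  finally show ?thesis by (simp add: x_def)
qed

section \<open>Binomial moments\<close>

text \<open>
  Pascal's rule as a recursion for expectations: one more fair coin toss.
\<close>

lemma sum_binomial_shift:
  fixes f :: "nat \<Rightarrow> real"
  shows "(\<Sum>j\<le>Suc n. real (Suc n choose j) * f j) = (\<Sum>j\<le>n. real (n choose j) * (f j + f (Suc j)))"
proof -
  have "(\<Sum>j\<le>Suc n. real (Suc n choose j) * f j) = f 0 + (\<Sum>j\<le>n. real (Suc n choose Suc j) * f (Suc j))"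
    by (subst sum.atMost_Suc_shift) simp
  also have "\<dots> = (f 0 + (\<Sum>j\<le>n. real (n choose Suc j) * f (Suc j))) + (\<Sum>j\<le>n. real (n choose j) * f (Suc j))"
    by (simp add: algebra_simps sum.distrib)
  also have "f 0 + (\<Sum>j\<le>n. real (n choose Suc j) * f (Suc j)) = (\<Sum>j\<le>Suc n. real (n choose j) * f j)"
    by (subst sum.atMost_Suc_shift) simp
  finally show ?thesis by (simp add: algebra_simps sum.distrib)
qed

lemma binomial_moment_2: "(\<Sum>j\<le>n. real (n choose j) * (2 * real j - real n)\<^sup>2) = real n * 2 ^ n"
proof (induction n)
  case (Suc n)
  have "(\<Sum>j\<le>Suc n. real (Suc n choose j) * (2 * real j - real (Suc n))\<^sup>2)
      = (\<Sum>j\<le>n. real (n choose j) * (2 * (2 * real j - real n)\<^sup>2 + 2))"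
    unfolding sum_binomial_shift by (intro sum.cong refl arg_cong2[where f = "(*)"]) (simp add: power2_eq_square algebra_simps)
  also have "\<dots> = 2 * (\<Sum>j\<le>n. real (n choose j) * (2 * real j - real n)\<^sup>2) + 2 * (\<Sum>j\<le>n. real (n choose j))"
    by (simp add: sum.distrib sum_distrib_left algebra_simps)
  also have "(\<Sum>j\<le>n. real (n choose j)) = 2 ^ n"
    by (simp add: choose_row_sum flip: of_nat_sum)
  finally show ?case using Suc by (simp add: algebra_simps)
qed simp

lemma binomial_moment_4: "(\<Sum>j\<le>n. real (n choose j) * (2 * real j - real n) ^ 4) = (3 * real n ^ 2 - 2 * real n) * 2 ^ n"
proof (induction n)
  case (Suc n)
  have *: "(2 * real j - real (Suc n)) ^ 4 + (2 * real (Suc j) - real (Suc n)) ^ 4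
     = 2 * (2 * real j - real n) ^ 4 + 12 * (2 * real j - real n)\<^sup>2 + 2" for j
  proof -
    define t where "t = 2 * real j - real n"
    have "2 * real j - real (Suc n) = t - 1" "2 * real (Suc j) - real (Suc n) = t + 1" by (simp_all add: t_def)
    then show ?thesis unfolding t_def[symmetric] by (simp add: power2_eq_square power4_eq_xxxx algebra_simps)
  qed
  have "(\<Sum>j\<le>Suc n. real (Suc n choose j) * (2 * real j - real (Suc n)) ^ 4)
      = (\<Sum>j\<le>n. real (n choose j) * (2 * (2 * real j - real n) ^ 4 + 12 * (2 * real j - real n)\<^sup>2 + 2))"
    unfolding sum_binomial_shift * ..
  also have "\<dots> = 2 * (\<Sum>j\<le>n. real (n choose j) * (2 * real j - real n) ^ 4)
     + 12 * (\<Sum>j\<le>n. real (n choose j) * (2 * real j - real n)\<^sup>2) + 2 * (\<Sum>j\<le>n. real (n choose j))"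
    by (simp add: sum.distrib sum_distrib_left algebra_simps)
  also have "(\<Sum>j\<le>n. real (n choose j)) = 2 ^ n"
    by (simp add: choose_row_sum flip: of_nat_sum)
  finally show ?case unfolding binomial_moment_2 Suc by (simp add: power2_eq_square algebra_simps)
qed simp

text \<open>
  The reflection \<open>j \<mapsto> n - j\<close> pairs the lower with the upper half of an odd row.
\<close>

lemma half_sum_odd_binomial:
  fixes f :: "real \<Rightarrow> real"
  assumes even: "\<And>x. f (- x) = f x"
  shows "(\<Sum>m=1..Suc N. real (Suc (2 * N) choose (N + m)) * f (2 * real m - 1)) =
    (\<Sum>j\<le>Suc (2 * N). real (Suc (2 * N) choose j) * f (2 * real j - real (Suc (2 * N)))) / 2"
proof -
  define n where "n = Suc (2 * N)"
  define g where "g j = real (n choose j) * f (2 * real j - real n)" for j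
  have upper: "(\<Sum>m=1..Suc N. real (n choose (N + m)) * f (2 * real m - 1)) = sum g {Suc N..n}"
    by (rule sum.reindex_bij_witness[of _ "\<lambda>j. j - N" "\<lambda>m. N + m"]) (auto simp: g_def n_def)
  have "sum g {..N} = sum g {Suc N..n}"
  proof (rule sum.reindex_bij_witness[of _ "\<lambda>j. n - j" "\<lambda>j. n - j"])
    fix j assume "j \<in> {..N}"
    then have j: "j \<le> n" by (simp add: n_def)
    have "2 * real (n - j) - real n = - (2 * real j - real n)"
      using j by simp
    then show "g (n - j) = g j"
      using binomial_symmetric[OF j] unfolding g_def by (simp only: even)
  qed (auto simp: n_def)
  moreover have "sum g {..n} = sum g {..N} + sum g {Suc N..n}"
  proof -
    have "{..n} = {..N} \<union> {Suc N..n}" by (auto simp: n_def)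
    then show ?thesis by (simp add: sum.union_disjoint)
  qed
  ultimately show ?thesis
    using upper unfolding n_def[symmetric] g_def[symmetric] by simp
qed

section \<open>The harmonic part of the divisor sum\<close>

lemma half_sum_odd_binomial_1: "(\<Sum>m=1..Suc N. real (Suc (2 * N) choose (N + m))) = 4 ^ N"
proof -
  have "(\<Sum>j\<le>Suc (2 * N). real (Suc (2 * N) choose j)) = 2 ^ Suc (2 * N)"
    by (simp only: choose_row_sum of_nat_sum[symmetric]) simp
  then show ?thesis
    using half_sum_odd_binomial[of "\<lambda>_. 1" N] by (simp add: power_mult del: binomial_Suc_Suc)
qed

lemma sum_binom_diff2: "(\<Sum>m=1..Suc N. binom_diff2 N m) = catalan_real N"
proof -
  have *: "(\<Sum>m=1..K. binom_diff2 N m) = binom_diff1 N 1 - binom_diff1 N (Suc K)" for K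
    by (induction K) (simp_all add: binom_diff2_eq_diff)
  show ?thesis unfolding * by (simp add: binom_diff1_def catalan_real_def binomial_eq_0)
qed

lemma sum_harm_binom_diff2:
  "(\<Sum>m=1..Suc N. harm m * binom_diff2 N m) = (\<Sum>m=1..Suc N. binom_diff1 N m / real m)"
proof -
  have *: "(\<Sum>m=1..K. harm m * binom_diff2 N m) =
      (\<Sum>m=1..K. binom_diff1 N m / real m) - harm K * binom_diff1 N (Suc K)" for K
    by (induction K)
      (simp_all add: binom_diff2_eq_diff harm_Suc harm_expand algebra_simps divide_inverse del: of_nat_Suc)
  show ?thesis unfolding * by (simp add: binom_diff1_def binomial_eq_0)
qed

text \<open>
  The first difference of the binomial row at \<open>m\<close> carries the factor \<open>2 m - 1\<close>, so division by \<open>m\<close> leaves \<open>2\<close>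
  times an entry of the row \<open>2 N + 1\<close>, whose half sum is \<open>4^N\<close>. The remainder carries \<open>1/m\<close> and is
  bounded by the largest entry times a harmonic number.
\<close>

lemma sum_harm_binom_diff2_approx:
  "\<bar>(\<Sum>m=1..Suc N. harm m * binom_diff2 N m) / catalan_real N
     - 2 * (real N + 1) / (2 * real N + 1) * (4 ^ N / real (2 * N choose N))\<bar> \<le> 2 * harm (Suc N)"
proof -
  define c where "c m = real (Suc (2 * N) choose (N + m))" for m
  define b where "b = real (2 * N choose N)"
  have b: "b > 0" by (simp add: b_def)
  define r where "r = (\<Sum>m=1..Suc N. c m / real m)"
  define X where "X = (\<Sum>m=1..Suc N. harm m * binom_diff2 N m)"
  have c_max: "c m \<le> 2 * b" for m
  proof -
    have "Suc (2 * N) choose (N + m) \<le> Suc (2 * N) choose N"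
      using binomial_maximum[of "Suc (2 * N)" "N + m"] by (simp del: binomial_Suc_Suc)
    then have "c m \<le> real (Suc (2 * N) choose N)" by (simp add: c_def del: binomial_Suc_Suc)
    moreover have "(real N + 1) * real (Suc (2 * N) choose N) = (2 * real N + 1) * b"
      using binomial_absorb_real[of "2 * N" N] by (simp add: b_def del: binomial_Suc_Suc)
    then have "real (Suc (2 * N) choose N) = (2 * real N + 1) / (real N + 1) * b"
      by (simp add: field_simps del: binomial_Suc_Suc)
    moreover have "(2 * real N + 1) / (real N + 1) * b \<le> 2 * b"
      using b by (intro mult_right_mono) (simp_all add: field_simps)
    ultimately show ?thesis by linarith
  qed
  have "(2 * real N + 1) * (\<Sum>m=1..Suc N. binom_diff1 N m / real m) = (\<Sum>m=1..Suc N. 2 * c m - c m / real m)"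
    unfolding sum_distrib_left
  proof (intro sum.cong refl)
    fix m assume "m \<in> {1..Suc N}"
    then show "(2 * real N + 1) * (binom_diff1 N m / real m) = 2 * c m - c m / real m"
      using binom_diff1_eq[of m N] by (simp add: c_def field_simps del: binomial_Suc_Suc)
  qed
  also have "\<dots> = 2 * 4 ^ N - r"
    using half_sum_odd_binomial_1[of N]
    by (simp only: sum_subtractf r_def c_def sum_distrib_left[symmetric])
  finally have X: "X = (2 * 4 ^ N - r) / (2 * real N + 1)"
    unfolding X_def[unfolded sum_harm_binom_diff2, symmetric] by (simp add: field_simps)
  have "X / catalan_real N
     - 2 * (real N + 1) / (2 * real N + 1) * (4 ^ N / b) = - ((real N + 1) / (2 * real N + 1) * (r / b))"
    using b by (simp add: X catalan_real_eq b_def[symmetric] divide_simps) (simp add: algebra_simps)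
  also have "\<bar>\<dots>\<bar> \<le> 1 * (r / b)"
  proof -
    have "0 \<le> r" by (simp add: r_def c_def sum_nonneg)
    then show ?thesis
      unfolding abs_minus_cancel abs_mult using b by (intro mult_mono) (auto simp: field_simps)
  qed
  also have "\<dots> \<le> 2 * harm (Suc N)"
  proof -
    have "r \<le> (\<Sum>m=1..Suc N. 2 * b / real m)"
      unfolding r_def by (intro sum_mono divide_right_mono c_max) simp
    also have "\<dots> = 2 * b * harm (Suc N)"
      by (simp only: harm_def sum_distrib_left divide_inverse)
    finally show ?thesis using b by (simp add: field_simps)
  qed
  finally show ?thesis by (simp only: b_def X_def)
qed

section \<open>The error part of the divisor sum\<close>

lemma sum_by_parts:
  fixes e w :: "nat \<Rightarrow> real"
  shows "(\<Sum>m=1..K. e m * w m) =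
    (\<Sum>m=1..K. (\<Sum>j=1..m. e j) * (w m - w (Suc m))) + (\<Sum>j=1..K. e j) * w (Suc K)"
  by (induction K) (simp_all add: algebra_simps)

text \<open>
  Replaces the power \<open>t^(3/2)\<close> by even powers of \<open>t\<close>, for which binomial moments are available. Both terms on
  the right have the same size at the scale \<open>t = s^2\<close>.
\<close>

lemma sqrt_mult_le:
  assumes "0 \<le> t" "0 < (s :: real)"
  shows "sqrt t * t \<le> t\<^sup>2 / s + s ^ 3"
proof -
  define u where "u = sqrt t"
  have u: "u \<ge> 0" "t = u\<^sup>2" using assms by (simp_all add: u_def)
  have "u ^ 3 \<le> u ^ 4 / s + s ^ 3"
  proof (cases "u \<le> s")
    case True
    then have "u ^ 3 \<le> s ^ 3" using u by (intro power_mono) auto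
    moreover have "0 \<le> u ^ 4 / s" using assms by simp
    ultimately show ?thesis by linarith
  next
    case False
    then have "u ^ 3 * s \<le> u ^ 3 * u" using u by (intro mult_left_mono) auto
    then have "u ^ 3 \<le> u ^ 4 / s" using assms by (simp add: field_simps power4_eq_xxxx power3_eq_cube)
    then show ?thesis using assms by (simp add: add_increasing2)
  qed
  then show ?thesis
    unfolding u(2) using u(1) by (simp add: power3_eq_cube power4_eq_xxxx power2_eq_square algebra_simps)
qed

text \<open>
  With \<open>s = M^(1/4)\<close>, the typical size \<open>sqrt M\<close> of \<open>x = 2 m - 1\<close> is \<open>s^2\<close>, and every term of the expanded
  polynomial has order \<open>s^7\<close>.
\<close>

lemma weighted_moment_bound:
  fixes s :: real
  assumes "s > 0" "s ^ 4 = real M" "M \<ge> 1"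
  shows "(\<Sum>m=1..Suc M. real (Suc (2 * M) choose (M + m)) *
      (((2 * real m - 1)\<^sup>2 / s + s ^ 3) * ((2 * real m - 1)\<^sup>2 / 2 + 3 * real M))) \<le> 27 * 4 ^ M * s ^ 7"
proof -
  define n where "n = Suc (2 * M)"
  define P where "P x = (x\<^sup>2 / s + s ^ 3) * (x\<^sup>2 / 2 + 3 * real M)" for x :: real
  have P: "P x = 1 / (2 * s) * x ^ 4 + 7 / 2 * s ^ 3 * x\<^sup>2 + 3 * s ^ 7" for x
    unfolding P_def assms(2)[symmetric] using assms(1)
    by (simp add: divide_simps) (simp add: algebra_simps power2_eq_square power3_eq_cube power4_eq_xxxx eval_nat_numeral)
  have n: "real n \<le> 3 * s ^ 4" using assms(3) by (simp add: n_def assms(2))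
  have "(\<Sum>m=1..Suc M. real (n choose (M + m)) * P (2 * real m - 1)) =
      (\<Sum>j\<le>n. real (n choose j) * P (2 * real j - real n)) / 2"
    unfolding n_def by (rule half_sum_odd_binomial) (simp add: P_def)
  also have "(\<Sum>j\<le>n. real (n choose j) * P (2 * real j - real n)) =
      1 / (2 * s) * (\<Sum>j\<le>n. real (n choose j) * (2 * real j - real n) ^ 4)
      + 7 / 2 * s ^ 3 * (\<Sum>j\<le>n. real (n choose j) * (2 * real j - real n)\<^sup>2)
      + 3 * s ^ 7 * (\<Sum>j\<le>n. real (n choose j))"
    unfolding P by (simp only: distrib_left sum.distrib sum_distrib_left mult_ac)
  also have "\<dots> = 2 ^ n * (1 / (2 * s) * (3 * real n ^ 2 - 2 * real n) + 7 / 2 * s ^ 3 * real n + 3 * s ^ 7)"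
    unfolding binomial_moment_2 binomial_moment_4
    by (simp add: choose_row_sum algebra_simps flip: of_nat_sum)
  also have "\<dots> \<le> 2 ^ n * (1 / (2 * s) * (27 * s ^ 8) + 7 / 2 * s ^ 3 * (3 * s ^ 4) + 3 * s ^ 7)"
  proof -
    have "real n ^ 2 \<le> (3 * s ^ 4) ^ 2" using n by (intro power_mono) auto
    then have "3 * real n ^ 2 - 2 * real n \<le> 27 * s ^ 8"
      by (simp add: power_mult_distrib flip: power_mult)
    then show ?thesis using n assms(1) by (intro mult_left_mono add_mono) auto
  qed
  also have "\<dots> = 2 ^ n * (27 * s ^ 7)"
    using assms(1) by (simp add: field_simps eval_nat_numeral)
  finally have "(\<Sum>m=1..Suc M. real (n choose (M + m)) * P (2 * real m - 1)) \<le> 2 ^ n * (27 * s ^ 7) / 2" by simp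
  also have "\<dots> = 27 * 4 ^ M * s ^ 7"
    by (simp add: n_def power_mult)
  finally show ?thesis by (simp only: n_def P_def)
qed

text \<open>
  Partial sums of size \<open>sqrt m\<close> meet a third difference, which is an entry of the row \<open>2 M + 1\<close> times a
  polynomial cubic in \<open>m\<close> and \<open>sqrt M\<close> jointly, divided by a quantity of order \<open>M^3\<close>. At the typical scale \<open>m = sqrt M\<close> this gives
  \<open>M^(1/4) M^(3/2) M^(-3)\<close> times a row sum, that is \<open>4^M M^(-5/4)\<close> up to a constant.
\<close>

lemma abel_error_bound:
  fixes e :: "nat \<Rightarrow> real"
  assumes E: "\<And>m. \<bar>\<Sum>j=1..m. e j\<bar> \<le> C * sqrt (real m)" and "C \<ge> 0" and M: "M = Suc N"
  shows "\<bar>\<Sum>m=1..Suc N. e m * binom_diff2 N m\<bar> \<le> 9 * C * 4 ^ M * real M powr (- 5 / 4)"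
proof -
  define s where "s = real M powr (1 / 4)"
  have s: "s > 0" "s ^ 4 = real M" "M \<ge> 1"
    by (simp_all add: s_def M powr_realpow[symmetric] powr_powr)
  define c where "c m = real (Suc (2 * M) choose (M + m))" for m
  define Q where "Q = real M * (2 * real M - 1) * (2 * real M + 1)"
  have Q: "Q > 0" "3 * real M ^ 3 \<le> Q"
  proof -
    have "1 \<le> real M ^ 2" using s(3) by simp
    then have "3 * real M ^ 2 \<le> (2 * real M - 1) * (2 * real M + 1)"
      by (simp add: algebra_simps power2_eq_square)
    then have "real M * (3 * real M ^ 2) \<le> real M * ((2 * real M - 1) * (2 * real M + 1))"
      by (intro mult_left_mono) auto
    then show "3 * real M ^ 3 \<le> Q" by (simp add: Q_def power2_eq_square power3_eq_cube mult_ac)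
    moreover have "0 < real M ^ 3" using s(3) by simp
    ultimately show "Q > 0" by linarith
  qed
  define G where "G m = c m * (((2 * real m - 1)\<^sup>2 / s + s ^ 3) * ((2 * real m - 1)\<^sup>2 / 2 + 3 * real M))" for m
  have "binom_diff2 N (Suc (Suc N)) = 0"
    by (simp add: binom_diff2_def binomial_eq_0)
  then have "(\<Sum>m=1..Suc N. e m * binom_diff2 N m) =
      (\<Sum>m=1..M. (\<Sum>j=1..m. e j) * (binom_diff2 N m - binom_diff2 N (Suc m)))"
    using sum_by_parts[of e "binom_diff2 N" "Suc N"] by (simp only: M)
  also have "\<bar>\<dots>\<bar> \<le> (\<Sum>m=1..M. C / Q * G (Suc m))"
  proof (intro order.trans[OF sum_abs] sum_mono)
    fix m assume m: "m \<in> {1..M}"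
    define t where "t = 2 * real m + 1"
    have t: "t \<ge> 0" by (simp add: t_def)
    have t': "2 * real (Suc m) - 1 = t" by (simp add: t_def)
    have "Q * (binom_diff2 N m - binom_diff2 N (Suc m)) = t * (2 * real m * (real m + 1) - 3 * real M) * c (Suc m)"
      using binom_diff3_eq[OF _ M, of m] m by (simp add: Q_def c_def t_def del: binomial_Suc_Suc)
    then have eq: "binom_diff2 N m - binom_diff2 N (Suc m) = t * c (Suc m) / Q * (2 * real m * (real m + 1) - 3 * real M)"
      using Q(1) by (simp add: field_simps)
    have 1: "\<bar>2 * real m * (real m + 1) - 3 * real M\<bar> \<le> t\<^sup>2 / 2 + 3 * real M"
      unfolding abs_le_iff by (simp add: t_def power2_eq_square field_simps)
    have c0: "c (Suc m) \<ge> 0" by (simp add: c_def)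
    have "\<bar>(\<Sum>j=1..m. e j) * (binom_diff2 N m - binom_diff2 N (Suc m))\<bar>
        = \<bar>\<Sum>j=1..m. e j\<bar> * (t * c (Suc m) / Q * \<bar>2 * real m * (real m + 1) - 3 * real M\<bar>)"
      unfolding eq abs_mult using t Q(1) c0 by simp
    also have "\<dots> \<le> (C * sqrt t) * (t * c (Suc m) / Q * (t\<^sup>2 / 2 + 3 * real M))"
    proof (intro mult_mono order.refl 1)
      have "C * sqrt (real m) \<le> C * sqrt t" using assms(2) by (intro mult_left_mono) (simp_all add: t_def)
      then show "\<bar>\<Sum>j=1..m. e j\<bar> \<le> C * sqrt t" using E[of m] by linarith
    qed (use t Q(1) c0 assms(2) in auto)
    also have "\<dots> = (C / Q * c (Suc m)) * ((sqrt t * t) * (t\<^sup>2 / 2 + 3 * real M))"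
      by (simp add: mult_ac)
    also have "\<dots> \<le> (C / Q * c (Suc m)) * ((t\<^sup>2 / s + s ^ 3) * (t\<^sup>2 / 2 + 3 * real M))"
      using sqrt_mult_le[OF t s(1)] assms(2) Q(1) c0 by (intro mult_left_mono mult_right_mono) auto
    also have "\<dots> = C / Q * G (Suc m)"
      unfolding G_def t' by (simp add: mult_ac)
    finally show "\<bar>(\<Sum>j=1..m. e j) * (binom_diff2 N m - binom_diff2 N (Suc m))\<bar> \<le> C / Q * G (Suc m)" .
  qed
  also have "\<dots> = C / Q * (\<Sum>m=1..M. G (Suc m))"
    by (simp add: sum_distrib_left)
  also have "\<dots> \<le> C / (3 * real M ^ 3) * (27 * 4 ^ M * s ^ 7)"
  proof (rule mult_mono)
    show "C / Q \<le> C / (3 * real M ^ 3)"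
      using Q assms(2) s(3) by (intro divide_left_mono) auto
    have "(\<Sum>m=1..M. G (Suc m)) = sum G {Suc 1..Suc M}"
      by (simp only: sum.atLeast_Suc_atMost_Suc_shift o_def)
    also have "\<dots> \<le> sum G {1..Suc M}"
      using s(1) by (intro sum_mono2) (auto simp: G_def c_def)
    also have "\<dots> \<le> 27 * 4 ^ M * s ^ 7"
      unfolding G_def c_def by (rule weighted_moment_bound[OF s])
    finally show "(\<Sum>m=1..M. G (Suc m)) \<le> 27 * 4 ^ M * s ^ 7" .
    show "0 \<le> (\<Sum>m=1..M. G (Suc m))"
      using s(1) by (intro sum_nonneg) (auto simp: G_def c_def)
  qed (use assms(2) in simp)
  also have "\<dots> = 9 * C * 4 ^ M * (s ^ 7 / real M ^ 3)"
    by simp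
  also have "s ^ 7 / real M ^ 3 = real M powr (- 5 / 4)"
  proof -
    have 1: "s ^ 7 = s powr 7" "real M ^ 3 = real M powr 3"
      using s(1,3) by simp_all
    show ?thesis
      unfolding 1 unfolding s_def powr_powr powr_diff[symmetric] by simp
  qed
  finally show ?thesis .
qed

section \<open>Asymptotics of the average height\<close>

text \<open>
  Up to sign, \<open>(2N choose N) / 4^N\<close> is the generalised binomial coefficient \<open>-1/2 gchoose N\<close>, whose asymptotics
  is a form of Euler's limit for the Gamma function at \<open>1/2\<close>.
\<close>

lemma central_binomial_asymptotic:
  "(\<lambda>N. 4 ^ N / real (2 * N choose N)) \<sim>[sequentially] (\<lambda>N. sqrt (pi * real N))"
proof -
  have eq: "((-1/2 :: real) gchoose n) / ((-1)^n / exp ((-1/2+1) * of_real (ln (real n)))) =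
      sqrt (real n) / (4 ^ n / real (2 * n choose n))" if "n > 0" for n
  proof -
    have "real (2 * n choose n) = fact (2 * n) / (fact n * fact n)"
      by (simp add: binomial_fact mult_2)
    also have "\<dots> = 4 ^ n * (pochhammer (1/2) n / fact n)"
      by (subst fact_double) (simp add: power_mult)
    finally have "((-1/2 :: real) gchoose n) = (-1) ^ n * (real (2 * n choose n) / 4 ^ n)"
      by (simp add: gbinomial_pochhammer)
    moreover have "exp (1/2 * ln (real n)) = sqrt (real n)"
      using that by (simp add: powr_def flip: powr_half_sqrt)
    ultimately show ?thesis by (simp add: field_simps)
  qed
  have "(\<lambda>n. ((-1/2 :: real) gchoose n) / ((-1)^n / exp ((-1/2+1) * of_real (ln (real n))))) \<longlonglongrightarrow>
           inverse (Gamma (1/2))"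
    using gbinomial_asymptotic[of "-1/2 :: real"] by simp
  then have "(\<lambda>n. sqrt (real n) / (4 ^ n / real (2 * n choose n))) \<longlonglongrightarrow> inverse (sqrt pi)"
    unfolding Gamma_one_half_real
    proof (rule Lim_transform_eventually)
    show "\<forall>\<^sub>F n in sequentially. ((-1/2 :: real) gchoose n) / ((-1)^n / exp ((-1/2+1) * of_real (ln (real n)))) =
      sqrt (real n) / (4 ^ n / real (2 * n choose n))"
      using eventually_gt_at_top[of "0::nat"] by (rule eventually_mono) (rule eq)
  qed
  from tendsto_mult[OF this tendsto_const[of "sqrt pi"]]
  have "(\<lambda>n. sqrt (pi * real n) / (4 ^ n / real (2 * n choose n))) \<longlonglongrightarrow> 1"
    by (simp add: real_sqrt_mult mult_ac)
  then have "(\<lambda>N. sqrt (pi * real N)) \<sim>[sequentially] (\<lambda>N. 4 ^ N / real (2 * N choose N))"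
    by (intro asymp_equivI') simp
  then show ?thesis by (rule asymp_equiv_symI)
qed

lemma average_height_approx:
  fixes n :: nat
  defines "N \<equiv> Suc n"
  defines "A \<equiv> 4 ^ N / real (2 * N choose N)"
  shows "\<bar>average_height n - 2 * (real N + 1) / (2 * real N + 1) * A\<bar> \<le>
    2 + 2 * harm (Suc N) + 1440 * (A * real (Suc N) powr (- 1 / 4))"
proof -
  define b where "b = real (2 * N choose N)"
  define g :: real where "g = euler_mascheroni"
  define e where "e m = real (card {L. L dvd m}) - (harm m + g)" for m :: nat
  define X where "X = (\<Sum>m=1..Suc N. harm m * binom_diff2 N m)"
  define Y where "Y = (\<Sum>m=1..Suc N. e m * binom_diff2 N m)"
  define c where "c = catalan_real N"
  have b: "b > 0" by (simp add: b_def)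
  have c: "c = b / real (Suc N)" "c > 0"
    using b by (simp_all add: c_def catalan_real_eq b_def)
  have "(\<Sum>m=1..Suc N. real (card {L. L dvd m}) * binom_diff2 N m) =
      (\<Sum>m=1..Suc N. harm m * binom_diff2 N m + g * binom_diff2 N m + e m * binom_diff2 N m)"
    by (intro sum.cong refl) (simp add: e_def algebra_simps)
  also have "\<dots> = X + g * c + Y"
    by (simp only: sum.distrib X_def Y_def c_def sum_distrib_left[symmetric] sum_binom_diff2)
  finally have "average_height n = (X + g * c + Y - 2 * c) / c"
    using sum_path_height_eq_divisor_sum[of n] real_card_partial_lukasiewicz_rl[of n]
    by (simp only: average_height_def N_def c_def) simp
  then have avg: "average_height n = X / c + (g - 2) + Y / c"
    using c(2) by (simp add: field_simps)
  have 1: "\<bar>X / c - 2 * (real N + 1) / (2 * real N + 1) * A\<bar> \<le> 2 * harm (Suc N)"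
    using sum_harm_binom_diff2_approx[of N] by (simp only: X_def c_def A_def)
  have 2: "\<bar>g - 2\<bar> \<le> 2"
    using euler_mascheroni_pos euler_mascheroni_less_13_over_22 by (simp add: g_def)
  have 3: "\<bar>Y / c\<bar> \<le> 1440 * (A * real (Suc N) powr (- 1 / 4))"
  proof -
    have "\<bar>Y\<bar> \<le> 9 * 40 * 4 ^ Suc N * real (Suc N) powr (- 5 / 4)"
      unfolding Y_def
    proof (rule abel_error_bound)
      show "\<bar>\<Sum>j=1..m. e j\<bar> \<le> 40 * sqrt (real m)" for m
        unfolding e_def g_def by (rule dirichlet_divisor_error)
    qed simp_all
    then have "\<bar>Y\<bar> / c \<le> 9 * 40 * 4 ^ Suc N * real (Suc N) powr (- 5 / 4) / c"
      using c(2) by (intro divide_right_mono) auto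
    also have "\<dots> = 1440 * (4 ^ N / b * (real (Suc N) * real (Suc N) powr (- 5 / 4)))"
      by (simp add: c(1))
    also have "real (Suc N) * real (Suc N) powr (- 5 / 4) = real (Suc N) powr (1 + (- 5 / 4))"
      unfolding powr_add by simp
    finally show ?thesis using c(2) by (simp add: A_def b_def)
  qed
  show ?thesis unfolding avg using 1 2 3 by linarith
qed

theorem mainTheorem10:
  shows "average_height \<sim>[sequentially] (\<lambda>n. sqrt (pi * real n))"
proof -
  define A where "A n = 4 ^ Suc n / real (2 * Suc n choose Suc n)" for n
  define a where "a n = 2 * (real (Suc n) + 1) / (2 * real (Suc n) + 1) * A n" for n
  define r where "r n = average_height n - a n" for n
  let ?s = "\<lambda>n. sqrt (pi * real n)"
  have "A \<sim>[sequentially] (\<lambda>n. sqrt (pi * real (Suc n)))"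
    unfolding A_def using central_binomial_asymptotic filterlim_Suc by (rule asymp_equiv_compose')
  also have "(\<lambda>n. sqrt (pi * real (Suc n))) \<sim>[sequentially] ?s"
    by real_asymp
  finally have A: "A \<sim>[sequentially] ?s" .
  have "(\<lambda>n. 2 * (real (Suc n) + 1) / (2 * real (Suc n) + 1)) \<sim>[sequentially] (\<lambda>_. 1)"
    by real_asymp
  from asymp_equiv_mult[OF this A] have a: "a \<sim>[sequentially] ?s"
    by (simp add: a_def[abs_def])
  have "(\<lambda>n. 2 + 2 * (ln (real (Suc (Suc n))) + 2)) \<in> o(?s)"
    by real_asymp
  moreover have "(\<lambda>n. real (Suc (Suc n)) powr (- 1 / 4)) \<in> o(\<lambda>_. 1 :: real)"
    by real_asymp
  from landau_o.big_small_mult[OF asymp_equiv_imp_bigo[OF A] this]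
  have "(\<lambda>n. 1440 * (A n * real (Suc (Suc n)) powr (- 1 / 4))) \<in> o(?s)"
    by simp
  ultimately have bound: "(\<lambda>n. 2 + 2 * (ln (real (Suc (Suc n))) + 2)
      + 1440 * (A n * real (Suc (Suc n)) powr (- 1 / 4))) \<in> o(?s)"
    by (rule sum_in_smallo)
  have "r \<in> o(?s)"
  proof (rule landau_o.big_small_trans[OF bigoI[where c = 1] bound], intro always_eventually allI)
    fix n
    have "harm (Suc (Suc n)) \<le> ln (real (Suc (Suc n))) + 2"
      by (rule harm_le) simp
    moreover have "\<bar>r n\<bar> \<le> 2 + 2 * harm (Suc (Suc n)) + 1440 * (A n * real (Suc (Suc n)) powr (- 1 / 4))"
      using average_height_approx[of n] by (simp only: r_def a_def A_def)
    ultimately have "\<bar>r n\<bar> \<le> 2 + 2 * (ln (real (Suc (Suc n))) + 2) + 1440 * (A n * real (Suc (Suc n)) powr (- 1 / 4))"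
      by (meson add_mono_thms_linordered_semiring(1,2,3) mult_left_mono order.refl order.trans zero_le_numeral)
    then show "norm (r n) \<le> 1 * norm (2 + 2 * (ln (real (Suc (Suc n))) + 2)
        + 1440 * (A n * real (Suc (Suc n)) powr (- 1 / 4)))"
      unfolding real_norm_def mult_1 by (rule order.trans[OF _ abs_ge_self])
  qed
  with a have "(\<lambda>n. a n + r n) \<sim>[sequentially] ?s"
    by (simp only: asymp_equiv_add_right)
  then show ?thesis by (simp add: r_def)
qed

end
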